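(* Let $(M(c),\varphi,\xi,\eta,g)$ be a conformal Kenmotsu space form and let $\acute{M}$ be a CR-hypersurface of $M(c)$ with unit normal vector field $N$ whose shape operator $A$ is scalar, $AX=\lambda X$ for all $X\in T\acute{M}$. If the Lee vector field satisfies $\omega^{\sharp}=N$ along $\acute{M}$, then $\lambda=\frac{1}{2}$.
   Context: An almost contact metric structure $(\varphi,\xi,\eta,g)$ on a $(2n+1)$-dimensional smooth manifold $M$ consists of a $(1,1)$-tensor field $\varphi$, a vector field $\xi$, a 1-form $\eta$ and a Riemannian metric $g$ with $\varphi^2=-\mathrm{Id}+\eta\otimes\xi$, $\eta(\xi)=1$, $\varphi\xi=0$, $\eta\circ\varphi=0$, $g(\varphi X,\varphi Y)=g(X,Y)-\eta(X)\eta(Y)$, $\eta(X)=g(X,\xi)$. It is a Kenmotsu structure if $(\nabla_X\varphi)Y=-g(X,\varphi Y)\xi-\eta(Y)\varphi X$, with $\nabla$ the Levi-Civita connection of $g$. $(M,\varphi,\xi,\eta,g)$ is a conformal Kenmotsu manifold if there is a positive smooth function $f:M\to\mathbb{R}$ (fixed throughout) such that $(\varphi,\ \tilde\xi=e^{-f/2}\xi,\ \tilde\eta=e^{f/2}\eta,\ \tilde g=e^{f}g)$ is a Kenmotsu structure on $M$. It is a conformal Kenmotsu space form, denoted $M(c)$, if moreover this Kenmotsu structure has constant $\varphi$-holomorphic sectional curvature $c$, i.e. the $\tilde g$-sectional curvature of $\mathrm{span}\{X,\varphi X\}$ equals the constant $c$ for all nonzero $X$ orthogonal to $\tilde\xi$.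 The 1-form $\omega$ is $\omega(X)=X(f)$, and the Lee vector field is $\omega^{\sharp}=\mathrm{grad} f$ (gradient with respect to $g$). A CR-hypersurface of $M$ is a $2n$-dimensional embedded submanifold $\acute{M}$ such that $\xi$ is tangent to $\acute{M}$ and $T\acute{M}$ is an orthogonal direct sum of distributions $D\oplus D^{\perp}$ with $\varphi(D_p)\subset D_p$ and $\varphi(D^{\perp}_p)\subset T_p^{\perp}\acute{M}$ for all $p\in\acute M$. With $N$ a unit normal vector field of $\acute{M}$ and $U=-\varphi N$, one takes $D^{\perp}=\mathrm{span}\{U,\xi\}$ and $D$ its orthogonal complement in $T\acute{M}$. $A$ is the shape operator with respect to $N$: $AX=-\nabla_XN$ for $X\in T\acute M$, where $\nabla$ is the Levi-Civita connection of $g$. $A$ is scalar if $AX=\lambda X$ for all $X\in T\acute{M}$, for some scalar function $\lambda$. *)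

theory Defs
  imports "HOL-Analysis.Analysis" "HOL-Library.Function_Algebras"
begin

section \<open>Smooth manifolds\<close>

text \<open>
  \<open>Ck_on k S f\<close>: \<open>f\<close> is of class \<open>C\<^sup>k\<close> on the open set \<open>S\<close>; the derivative of order
  \<open>k\<close> is handled through all iterated directional derivatives.
\<close>

primrec Ck_on :: "nat \<Rightarrow> 'e::real_normed_vector set \<Rightarrow> ('e \<Rightarrow> 'b::real_normed_vector) \<Rightarrow> bool" where
  "Ck_on 0 S f \<longleftrightarrow> continuous_on S f"
| "Ck_on (Suc k) S f \<longleftrightarrow>
     (\<forall>x\<in>S. f differentiable (at x)) \<and>
     (\<forall>v. Ck_on k S (\<lambda>x. frechet_derivative f (at x) v))"

definition smooth_on :: "'e::real_normed_vector set \<Rightarrow> ('e \<Rightarrow> 'b::real_normed_vector) \<Rightarrow> bool" where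
  "smooth_on S f \<longleftrightarrow> (\<forall>k. Ck_on k S f)"

text \<open>
  The underlying set of a manifold is a whole (Hausdorff, second countable) type \<open>'a\<close>, and the
  model space is a Euclidean space \<open>'e\<close>, so the dimension of the manifold is \<open>DIM('e)\<close>.
  A chart is a pair of an open domain and a coordinate map; the coordinate map is only
  meaningful on the domain.
\<close>

type_synonym ('a, 'e) chart = "'a set \<times> ('a \<Rightarrow> 'e)"

definition is_chart :: "('a::topological_space, 'e::euclidean_space) chart \<Rightarrow> bool" where
  "is_chart = (\<lambda>(U, \<psi>). open U \<and> open (\<psi> ` U) \<and> homeomorphism U (\<psi> ` U) \<psi> (inv_into U \<psi>))"

definition smooth_transition ::
    "('a::topological_space, 'e::euclidean_space) chart \<Rightarrow> ('a, 'e) chart \<Rightarrow> bool" where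
  "smooth_transition = (\<lambda>(U, \<psi>) (V, \<theta>). smooth_on (\<psi> ` (U \<inter> V)) (\<theta> \<circ> inv_into U \<psi>))"

definition smooth_atlas ::
    "('a::{t2_space, second_countable_topology}, 'e::euclidean_space) chart set \<Rightarrow> bool" where
  "smooth_atlas \<A> \<longleftrightarrow>
     (\<forall>c\<in>\<A>. is_chart c) \<and> (\<Union>c\<in>\<A>. fst c) = UNIV \<and>
     (\<forall>c\<in>\<A>. \<forall>d\<in>\<A>. smooth_transition c d)"

text \<open>The charts of the maximal atlas determined by \<open>\<A>\<close>.\<close>

definition compatible_chart ::
    "('a::topological_space, 'e::euclidean_space) chart set \<Rightarrow> ('a, 'e) chart \<Rightarrow> bool" where
  "compatible_chart \<A> c \<longleftrightarrow>
     is_chart c \<and> (\<forall>d\<in>\<A>. smooth_transition c d \<and> smooth_transition d c)"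

definition smooth_fun ::
    "('a::topological_space, 'e::euclidean_space) chart set \<Rightarrow> ('a \<Rightarrow> real) \<Rightarrow> bool" where
  "smooth_fun \<A> h \<longleftrightarrow> (\<forall>(U, \<psi>)\<in>\<A>. smooth_on (\<psi> ` U) (h \<circ> inv_into U \<psi>))"

definition smooth_curve ::
    "('a::topological_space, 'e::euclidean_space) chart set \<Rightarrow> real set \<Rightarrow> (real \<Rightarrow> 'a) \<Rightarrow> bool" where
  "smooth_curve \<A> I \<gamma> \<longleftrightarrow>
     continuous_on I \<gamma> \<and> (\<forall>(U, \<psi>)\<in>\<A>. smooth_on {t \<in> I. \<gamma> t \<in> U} (\<psi> \<circ> \<gamma>))"

section \<open>Tangent vectors and vector fields\<close>

text \<open>
  Tangent vectors at \<open>p\<close> are derivations at \<open>p\<close> of the algebra of smooth functions.  They are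
  represented by functionals on all functions that vanish on non-smooth arguments, so
  that equality of functionals is equality of tangent vectors.  Addition, negation and zero of
  tangent vectors and of vector fields are the pointwise ones.
\<close>

type_synonym 'a tvec = "('a \<Rightarrow> real) \<Rightarrow> real"
type_synonym 'a vfield = "'a \<Rightarrow> 'a tvec"

definition tscale :: "real \<Rightarrow> 'a tvec \<Rightarrow> 'a tvec" where
  "tscale r v = (\<lambda>h. r * v h)"

interpretation tvec: vector_space tscale
  by unfold_locales (auto simp: tscale_def fun_eq_iff algebra_simps)

definition vscale :: "('a \<Rightarrow> real) \<Rightarrow> 'a vfield \<Rightarrow> 'a vfield" where
  "vscale h X = (\<lambda>p. tscale (h p) (X p))"

definition tangent_space ::
    "('a::topological_space, 'e::euclidean_space) chart set \<Rightarrow> 'a \<Rightarrow> 'a tvec set" where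
  "tangent_space \<A> p = {v.
     (\<forall>h k. smooth_fun \<A> h \<longrightarrow> smooth_fun \<A> k \<longrightarrow> v (\<lambda>q. h q + k q) = v h + v k) \<and>
     (\<forall>r h. smooth_fun \<A> h \<longrightarrow> v (\<lambda>q. r * h q) = r * v h) \<and>
     (\<forall>h k. smooth_fun \<A> h \<longrightarrow> smooth_fun \<A> k \<longrightarrow>
        v (\<lambda>q. h q * k q) = h p * v k + k p * v h) \<and>
     (\<forall>h. \<not> smooth_fun \<A> h \<longrightarrow> v h = 0)}"

definition vector_field ::
    "('a::topological_space, 'e::euclidean_space) chart set \<Rightarrow> 'a vfield \<Rightarrow> bool" where
  "vector_field \<A> X \<longleftrightarrow>
     (\<forall>p. X p \<in> tangent_space \<A> p) \<and>
     (\<forall>h. smooth_fun \<A> h \<longrightarrow> smooth_fun \<A> (\<lambda>p. X p h))"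

definition lie_bracket :: "'a vfield \<Rightarrow> 'a vfield \<Rightarrow> 'a vfield" where
  "lie_bracket X Y = (\<lambda>p h. X p (\<lambda>q. Y q h) - Y p (\<lambda>q. X q h))"

section \<open>Tensor fields\<close>

definition one_form ::
    "('a::topological_space, 'e::euclidean_space) chart set \<Rightarrow> ('a \<Rightarrow> 'a tvec \<Rightarrow> real) \<Rightarrow> bool" where
  "one_form \<A> \<eta> \<longleftrightarrow>
     (\<forall>p. \<forall>v\<in>tangent_space \<A> p. \<forall>w\<in>tangent_space \<A> p. \<eta> p (v + w) = \<eta> p v + \<eta> p w) \<and>
     (\<forall>p r. \<forall>v\<in>tangent_space \<A> p. \<eta> p (tscale r v) = r * \<eta> p v) \<and>
     (\<forall>X. vector_field \<A> X \<longrightarrow> smooth_fun \<A> (\<lambda>p. \<eta> p (X p)))"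

definition tensor_field_11 ::
    "('a::topological_space, 'e::euclidean_space) chart set \<Rightarrow> ('a \<Rightarrow> 'a tvec \<Rightarrow> 'a tvec) \<Rightarrow> bool" where
  "tensor_field_11 \<A> \<phi> \<longleftrightarrow>
     (\<forall>p. \<forall>v\<in>tangent_space \<A> p. \<phi> p v \<in> tangent_space \<A> p) \<and>
     (\<forall>p. \<forall>v\<in>tangent_space \<A> p. \<forall>w\<in>tangent_space \<A> p. \<phi> p (v + w) = \<phi> p v + \<phi> p w) \<and>
     (\<forall>p r. \<forall>v\<in>tangent_space \<A> p. \<phi> p (tscale r v) = tscale r (\<phi> p v)) \<and>
     (\<forall>X. vector_field \<A> X \<longrightarrow> vector_field \<A> (\<lambda>p. \<phi> p (X p)))"

definition riemannian_metric ::
    "('a::topological_space, 'e::euclidean_space) chart set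
      \<Rightarrow> ('a \<Rightarrow> 'a tvec \<Rightarrow> 'a tvec \<Rightarrow> real) \<Rightarrow> bool" where
  "riemannian_metric \<A> g \<longleftrightarrow>
     (\<forall>p. \<forall>u\<in>tangent_space \<A> p. \<forall>v\<in>tangent_space \<A> p. \<forall>w\<in>tangent_space \<A> p.
        g p (u + v) w = g p u w + g p v w) \<and>
     (\<forall>p r. \<forall>v\<in>tangent_space \<A> p. \<forall>w\<in>tangent_space \<A> p. g p (tscale r v) w = r * g p v w) \<and>
     (\<forall>p. \<forall>v\<in>tangent_space \<A> p. \<forall>w\<in>tangent_space \<A> p. g p v w = g p w v) \<and>
     (\<forall>p. \<forall>v\<in>tangent_space \<A> p. v \<noteq> 0 \<longrightarrow> 0 < g p v v) \<and>
     (\<forall>X Y. vector_field \<A> X \<longrightarrow> vector_field \<A> Y \<longrightarrow> smooth_fun \<A> (\<lambda>p. g p (X p) (Y p)))"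

section \<open>Connections and curvature\<close>

text \<open>
  A connection is an operator \<open>nab X Y\<close> (\<open>= \<nabla>\<^sub>X Y\<close>) on smooth vector fields; its values on
  other arguments are irrelevant.
\<close>

definition affine_connection ::
    "('a::topological_space, 'e::euclidean_space) chart set
      \<Rightarrow> ('a vfield \<Rightarrow> 'a vfield \<Rightarrow> 'a vfield) \<Rightarrow> bool" where
  "affine_connection \<A> nab \<longleftrightarrow>
     (\<forall>X Y. vector_field \<A> X \<longrightarrow> vector_field \<A> Y \<longrightarrow> vector_field \<A> (nab X Y)) \<and>
     (\<forall>X Y Z. vector_field \<A> X \<longrightarrow> vector_field \<A> Y \<longrightarrow> vector_field \<A> Z \<longrightarrow>
        nab (X + Y) Z = nab X Z + nab Y Z \<and> nab X (Y + Z) = nab X Y + nab X Z) \<and>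
     (\<forall>X Y h. vector_field \<A> X \<longrightarrow> vector_field \<A> Y \<longrightarrow> smooth_fun \<A> h \<longrightarrow>
        nab (vscale h X) Y = vscale h (nab X Y) \<and>
        nab X (vscale h Y) = vscale h (nab X Y) + vscale (\<lambda>p. X p h) Y)"

definition levi_civita ::
    "('a::topological_space, 'e::euclidean_space) chart set
      \<Rightarrow> ('a \<Rightarrow> 'a tvec \<Rightarrow> 'a tvec \<Rightarrow> real) \<Rightarrow> ('a vfield \<Rightarrow> 'a vfield \<Rightarrow> 'a vfield) \<Rightarrow> bool" where
  "levi_civita \<A> g nab \<longleftrightarrow>
     affine_connection \<A> nab \<and>
     (\<forall>X Y. vector_field \<A> X \<longrightarrow> vector_field \<A> Y \<longrightarrow> nab X Y - nab Y X = lie_bracket X Y) \<and>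
     (\<forall>X Y Z. vector_field \<A> X \<longrightarrow> vector_field \<A> Y \<longrightarrow> vector_field \<A> Z \<longrightarrow>
        (\<forall>p. X p (\<lambda>q. g q (Y q) (Z q)) = g p (nab X Y p) (Z p) + g p (Y p) (nab X Z p)))"

definition curvature_tensor ::
    "('a vfield \<Rightarrow> 'a vfield \<Rightarrow> 'a vfield) \<Rightarrow> 'a vfield \<Rightarrow> 'a vfield \<Rightarrow> 'a vfield \<Rightarrow> 'a vfield" where
  "curvature_tensor nab X Y Z = nab X (nab Y Z) - nab Y (nab X Z) - nab (lie_bracket X Y) Z"

text \<open>
  Sectional curvature of the plane spanned by \<open>X p\<close> and \<open>Y p\<close>.  It depends on the vector fields
  \<open>X\<close> and \<open>Y\<close> only through their values at \<open>p\<close>.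
\<close>

definition sectional_curvature ::
    "('a \<Rightarrow> 'a tvec \<Rightarrow> 'a tvec \<Rightarrow> real) \<Rightarrow> ('a vfield \<Rightarrow> 'a vfield \<Rightarrow> 'a vfield)
      \<Rightarrow> 'a vfield \<Rightarrow> 'a vfield \<Rightarrow> 'a \<Rightarrow> real" where
  "sectional_curvature g nab X Y p =
     g p (curvature_tensor nab X Y Y p) (X p) /
     (g p (X p) (X p) * g p (Y p) (Y p) - (g p (X p) (Y p))\<^sup>2)"

definition gradient ::
    "('a::topological_space, 'e::euclidean_space) chart set
      \<Rightarrow> ('a \<Rightarrow> 'a tvec \<Rightarrow> 'a tvec \<Rightarrow> real) \<Rightarrow> ('a \<Rightarrow> real) \<Rightarrow> 'a vfield \<Rightarrow> bool" where
  "gradient \<A> g f L \<longleftrightarrow>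
     vector_field \<A> L \<and> (\<forall>p. \<forall>v\<in>tangent_space \<A> p. g p (L p) v = v f)"

section \<open>Conformal Kenmotsu space forms\<close>

definition almost_contact_metric ::
    "('a::topological_space, 'e::euclidean_space) chart set \<Rightarrow> ('a \<Rightarrow> 'a tvec \<Rightarrow> 'a tvec)
      \<Rightarrow> 'a vfield \<Rightarrow> ('a \<Rightarrow> 'a tvec \<Rightarrow> real) \<Rightarrow> ('a \<Rightarrow> 'a tvec \<Rightarrow> 'a tvec \<Rightarrow> real) \<Rightarrow> bool" where
  "almost_contact_metric \<A> \<phi> \<xi> \<eta> g \<longleftrightarrow>
     tensor_field_11 \<A> \<phi> \<and> vector_field \<A> \<xi> \<and> one_form \<A> \<eta> \<and> riemannian_metric \<A> g \<and>
     (\<forall>p. \<eta> p (\<xi> p) = 1 \<and> \<phi> p (\<xi> p) = 0) \<and>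
     (\<forall>p. \<forall>v\<in>tangent_space \<A> p.
        \<phi> p (\<phi> p v) = - v + tscale (\<eta> p v) (\<xi> p) \<and>
        \<eta> p (\<phi> p v) = 0 \<and>
        \<eta> p v = g p v (\<xi> p)) \<and>
     (\<forall>p. \<forall>v\<in>tangent_space \<A> p. \<forall>w\<in>tangent_space \<A> p.
        g p (\<phi> p v) (\<phi> p w) = g p v w - \<eta> p v * \<eta> p w)"

text \<open>\<open>(\<nabla>\<^sub>X \<phi>) Y\<close>\<close>

definition cov_deriv_11 ::
    "('a vfield \<Rightarrow> 'a vfield \<Rightarrow> 'a vfield) \<Rightarrow> ('a \<Rightarrow> 'a tvec \<Rightarrow> 'a tvec)
      \<Rightarrow> 'a vfield \<Rightarrow> 'a vfield \<Rightarrow> 'a vfield" where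
  "cov_deriv_11 nab \<phi> X Y = (\<lambda>p. nab X (\<lambda>q. \<phi> q (Y q)) p - \<phi> p (nab X Y p))"

definition kenmotsu ::
    "('a::topological_space, 'e::euclidean_space) chart set \<Rightarrow> ('a \<Rightarrow> 'a tvec \<Rightarrow> 'a tvec)
      \<Rightarrow> 'a vfield \<Rightarrow> ('a \<Rightarrow> 'a tvec \<Rightarrow> real) \<Rightarrow> ('a \<Rightarrow> 'a tvec \<Rightarrow> 'a tvec \<Rightarrow> real) \<Rightarrow> bool" where
  "kenmotsu \<A> \<phi> \<xi> \<eta> g \<longleftrightarrow>
     almost_contact_metric \<A> \<phi> \<xi> \<eta> g \<and>
     (\<exists>nab. levi_civita \<A> g nab \<and>
       (\<forall>X Y. vector_field \<A> X \<longrightarrow> vector_field \<A> Y \<longrightarrow>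
          (\<forall>p. cov_deriv_11 nab \<phi> X Y p =
             tscale (- g p (X p) (\<phi> p (Y p))) (\<xi> p) - tscale (\<eta> p (Y p)) (\<phi> p (X p)))))"

definition const_phi_sectional_curvature ::
    "('a::topological_space, 'e::euclidean_space) chart set \<Rightarrow> ('a \<Rightarrow> 'a tvec \<Rightarrow> 'a tvec)
      \<Rightarrow> 'a vfield \<Rightarrow> ('a \<Rightarrow> 'a tvec \<Rightarrow> 'a tvec \<Rightarrow> real) \<Rightarrow> real \<Rightarrow> bool" where
  "const_phi_sectional_curvature \<A> \<phi> \<xi> g c \<longleftrightarrow>
     (\<exists>nab. levi_civita \<A> g nab \<and>
       (\<forall>X p. vector_field \<A> X \<longrightarrow> X p \<noteq> 0 \<longrightarrow> g p (X p) (\<xi> p) = 0 \<longrightarrow>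
          sectional_curvature g nab X (\<lambda>q. \<phi> q (X q)) p = c))"

definition conformal_kenmotsu ::
    "('a::topological_space, 'e::euclidean_space) chart set \<Rightarrow> ('a \<Rightarrow> 'a tvec \<Rightarrow> 'a tvec)
      \<Rightarrow> 'a vfield \<Rightarrow> ('a \<Rightarrow> 'a tvec \<Rightarrow> real) \<Rightarrow> ('a \<Rightarrow> 'a tvec \<Rightarrow> 'a tvec \<Rightarrow> real)
      \<Rightarrow> ('a \<Rightarrow> real) \<Rightarrow> bool" where
  "conformal_kenmotsu \<A> \<phi> \<xi> \<eta> g f \<longleftrightarrow>
     almost_contact_metric \<A> \<phi> \<xi> \<eta> g \<and> smooth_fun \<A> f \<and> (\<forall>p. 0 < f p) \<and>
     kenmotsu \<A> \<phi> (vscale (\<lambda>p. exp (- f p / 2)) \<xi>) (\<lambda>p v. exp (f p / 2) * \<eta> p v)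
       (\<lambda>p v w. exp (f p) * g p v w)"

definition conformal_kenmotsu_space_form ::
    "('a::topological_space, 'e::euclidean_space) chart set \<Rightarrow> ('a \<Rightarrow> 'a tvec \<Rightarrow> 'a tvec)
      \<Rightarrow> 'a vfield \<Rightarrow> ('a \<Rightarrow> 'a tvec \<Rightarrow> real) \<Rightarrow> ('a \<Rightarrow> 'a tvec \<Rightarrow> 'a tvec \<Rightarrow> real)
      \<Rightarrow> ('a \<Rightarrow> real) \<Rightarrow> real \<Rightarrow> bool" where
  "conformal_kenmotsu_space_form \<A> \<phi> \<xi> \<eta> g f c \<longleftrightarrow>
     conformal_kenmotsu \<A> \<phi> \<xi> \<eta> g f \<and>
     const_phi_sectional_curvature \<A> \<phi> (vscale (\<lambda>p. exp (- f p / 2)) \<xi>)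
       (\<lambda>p v w. exp (f p) * g p v w) c"

section \<open>CR-hypersurfaces\<close>

text \<open>Embedded submanifolds are the subsets admitting slice charts around each of their points.\<close>

definition embedded_submanifold ::
    "('a::topological_space, 'e::euclidean_space) chart set \<Rightarrow> nat \<Rightarrow> 'a set \<Rightarrow> bool" where
  "embedded_submanifold \<A> k S \<longleftrightarrow>
     (\<forall>p\<in>S. \<exists>U \<psi> W. compatible_chart \<A> (U, \<psi>) \<and> p \<in> U \<and>
        subspace W \<and> dim W = k \<and> \<psi> ` (U \<inter> S) = \<psi> ` U \<inter> W)"

text \<open>\<open>T\<^sub>p S\<close>, as the set of velocities at \<open>p\<close> of smooth curves lying in \<open>S\<close>.\<close>

definition tangent_space_sub ::
    "('a::topological_space, 'e::euclidean_space) chart set \<Rightarrow> 'a set \<Rightarrow> 'a \<Rightarrow> 'a tvec set" where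
  "tangent_space_sub \<A> S p = {v \<in> tangent_space \<A> p.
     \<exists>\<gamma> \<epsilon>. 0 < \<epsilon> \<and> smooth_curve \<A> {-\<epsilon><..<\<epsilon>} \<gamma> \<and> \<gamma> ` {-\<epsilon><..<\<epsilon>} \<subseteq> S \<and> \<gamma> 0 = p \<and>
       (\<forall>h. smooth_fun \<A> h \<longrightarrow> v h = deriv (h \<circ> \<gamma>) 0)}"

definition normal_space_sub ::
    "('a::topological_space, 'e::euclidean_space) chart set
      \<Rightarrow> ('a \<Rightarrow> 'a tvec \<Rightarrow> 'a tvec \<Rightarrow> real) \<Rightarrow> 'a set \<Rightarrow> 'a \<Rightarrow> 'a tvec set" where
  "normal_space_sub \<A> g S p =
     {v \<in> tangent_space \<A> p. \<forall>w\<in>tangent_space_sub \<A> S p. g p v w = 0}"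

text \<open>\<open>V\<close> is a smooth vector field on the manifold extending the field \<open>N\<close> along \<open>S\<close> near \<open>p\<close>.\<close>

definition extends_near ::
    "('a::topological_space, 'e::euclidean_space) chart set
      \<Rightarrow> 'a set \<Rightarrow> 'a vfield \<Rightarrow> 'a \<Rightarrow> 'a vfield \<Rightarrow> bool" where
  "extends_near \<A> S N p V \<longleftrightarrow>
     vector_field \<A> V \<and> (\<exists>W. open W \<and> p \<in> W \<and> (\<forall>q\<in>S \<inter> W. V q = N q))"

text \<open>A vector field along \<open>S\<close> (not necessarily tangent to \<open>S\<close>); its values off \<open>S\<close> are irrelevant.\<close>

definition vector_field_along ::
    "('a::topological_space, 'e::euclidean_space) chart set \<Rightarrow> 'a set \<Rightarrow> 'a vfield \<Rightarrow> bool" where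
  "vector_field_along \<A> S N \<longleftrightarrow> (\<forall>p\<in>S. \<exists>V. extends_near \<A> S N p V)"

definition unit_normal_field ::
    "('a::topological_space, 'e::euclidean_space) chart set
      \<Rightarrow> ('a \<Rightarrow> 'a tvec \<Rightarrow> 'a tvec \<Rightarrow> real) \<Rightarrow> 'a set \<Rightarrow> 'a vfield \<Rightarrow> bool" where
  "unit_normal_field \<A> g S N \<longleftrightarrow>
     vector_field_along \<A> S N \<and>
     (\<forall>p\<in>S. N p \<in> normal_space_sub \<A> g S p \<and> g p (N p) (N p) = 1)"

text \<open>Distributions on \<open>S\<close>: locally spanned by a linearly independent smooth frame.\<close>

definition distribution_on ::
    "('a::topological_space, 'e::euclidean_space) chart set
      \<Rightarrow> 'a set \<Rightarrow> nat \<Rightarrow> ('a \<Rightarrow> 'a tvec set) \<Rightarrow> bool" where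
  "distribution_on \<A> S k D \<longleftrightarrow>
     (\<forall>p\<in>S. D p \<subseteq> tangent_space_sub \<A> S p) \<and>
     (\<forall>p\<in>S. \<exists>W E. open W \<and> p \<in> W \<and> (\<forall>i<k. vector_field \<A> (E i)) \<and>
        (\<forall>q\<in>S \<inter> W. inj_on (\<lambda>i. E i q) {..<k} \<and>
           tvec.independent ((\<lambda>i. E i q) ` {..<k}) \<and>
           D q = tvec.span ((\<lambda>i. E i q) ` {..<k})))"

definition CR_hypersurface ::
    "('a::topological_space, 'e::euclidean_space) chart set \<Rightarrow> nat
      \<Rightarrow> ('a \<Rightarrow> 'a tvec \<Rightarrow> 'a tvec) \<Rightarrow> 'a vfield \<Rightarrow> ('a \<Rightarrow> 'a tvec \<Rightarrow> 'a tvec \<Rightarrow> real)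
      \<Rightarrow> 'a set \<Rightarrow> ('a \<Rightarrow> 'a tvec set) \<Rightarrow> ('a \<Rightarrow> 'a tvec set) \<Rightarrow> bool" where
  "CR_hypersurface \<A> n \<phi> \<xi> g S D D' \<longleftrightarrow>
     embedded_submanifold \<A> (2 * n) S \<and>
     (\<forall>p\<in>S. \<xi> p \<in> tangent_space_sub \<A> S p) \<and>
     (\<exists>k. distribution_on \<A> S k D) \<and> (\<exists>k. distribution_on \<A> S k D') \<and>
     (\<forall>p\<in>S.
        (\<forall>v\<in>D p. \<forall>w\<in>D' p. g p v w = 0) \<and>
        tangent_space_sub \<A> S p = {v + w |v w. v \<in> D p \<and> w \<in> D' p} \<and>
        \<phi> p ` D p \<subseteq> D p \<and>
        \<phi> p ` D' p \<subseteq> normal_space_sub \<A> g S p)"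

text \<open>
  \<open>A X = - \<nabla>\<^sub>X N\<close>.  As \<open>N\<close> lives on \<open>S\<close> only, \<open>\<nabla>\<^sub>X N\<close> at \<open>p\<close> is \<open>(nab X V) p\<close> for a smooth
  extension \<open>V\<close> of \<open>N\<close> near \<open>p\<close> and a vector field \<open>X\<close> with prescribed value \<open>X p \<in> T\<^sub>p S\<close>;
  such extensions exist, and the result does not depend on them.
\<close>

definition shape_operator ::
    "('a::topological_space, 'e::euclidean_space) chart set
      \<Rightarrow> ('a vfield \<Rightarrow> 'a vfield \<Rightarrow> 'a vfield) \<Rightarrow> 'a set \<Rightarrow> 'a vfield
      \<Rightarrow> ('a \<Rightarrow> 'a tvec \<Rightarrow> 'a tvec) \<Rightarrow> bool" where
  "shape_operator \<A> nab S N A \<longleftrightarrow>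
     (\<forall>p\<in>S. \<forall>X V. vector_field \<A> X \<longrightarrow> X p \<in> tangent_space_sub \<A> S p \<longrightarrow>
        extends_near \<A> S N p V \<longrightarrow> A p (X p) = - nab X V p)"

end

theory Submission
  imports Defs
begin

text \<open>
  The Reeb field of a Kenmotsu structure is geodesic, so \<open>\<xi>\<close> is pregeodesic for
  \<open>e\<^sup>f g\<close>.  Since \<open>g(\<xi>, L) = 0\<close> on \<open>S\<close> and \<open>\<xi>\<close> is tangent to \<open>S\<close>, the Koszul
  formulas of \<open>e\<^sup>f g\<close> and of \<open>g\<close> for \<open>(\<xi>, \<xi>, L)\<close> differ along \<open>S\<close>, up to the
  factor \<open>e\<^sup>f\<close>, only by the term \<open>L(f) / 2 = 1 / 2\<close>; hence \<open>g(\<nabla>\<^sub>\<xi> \<xi>, N) = 1 / 2\<close>.  On the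
  other hand \<open>g(\<nabla>\<^sub>\<xi> \<xi>, N) = - g(\<xi>, \<nabla>\<^sub>\<xi> N) = g(\<xi>, A \<xi>) = \<lambda>\<close>.
\<close>

section \<open>Smooth functions\<close>

text \<open>Derivatives see only the germ of a map, and on an open set agreement of maps is
  agreement of germs. In the inductions below this lets an explicit formula, valid only on
  \<open>S\<close>, replace \<open>frechet_derivative\<close>.\<close>

lemma Ck_on_cong:
  assumes "open S" "\<And>x. x \<in> S \<Longrightarrow> f x = h x" "Ck_on k S f"
  shows "Ck_on k S h"
  using assms(2,3)
proof (induction k arbitrary: f h)
  case 0
  then show ?case by (simp cong: continuous_on_cong)
next
  case (Suc k)
  have d: "(f has_derivative F) (at x) \<Longrightarrow> (h has_derivative F) (at x)" if "x \<in> S" for x F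
    using has_derivative_transform_within_open[OF _ assms(1) that] Suc.prems(1) by blast
  have fd: "frechet_derivative f (at x) = frechet_derivative h (at x)" if "x \<in> S" for x
    using Suc.prems(2) that d frechet_derivative_at frechet_derivative_works
    by (metis Ck_on.simps(2))
  have "Ck_on k S (\<lambda>x. frechet_derivative h (at x) v)" for v
    by (rule Suc.IH[of "\<lambda>x. frechet_derivative f (at x) v"]) (use fd Suc.prems in auto)
  moreover have "h differentiable (at x)" if "x \<in> S" for x
    by (metis Ck_on.simps(2) Suc.prems(2) d differentiable_def that)
  ultimately show ?case by simp
qed

lemma Ck_on_Suc_imp: "Ck_on (Suc k) S f \<Longrightarrow> Ck_on k S f"
proof (induction k arbitrary: f)
  case 0
  then show ?case
    by (auto intro!: differentiable_imp_continuous_on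
        simp: differentiable_on_def differentiable_at_withinI)
next
  case (Suc k)
  then show ?case
    by (metis Ck_on.simps(2))
qed

lemma Ck_on_const: "Ck_on k S (\<lambda>x. c)"
  by (induction k arbitrary: c) (auto simp: frechet_derivative_const)

lemma Ck_on_add:
  assumes "open S" "Ck_on k S f" "Ck_on k S h"
  shows "Ck_on k S (\<lambda>x. f x + h x)"
  using assms(2,3)
proof (induction k arbitrary: f h)
  case 0
  then show ?case by (auto intro: continuous_intros)
next
  case (Suc k)
  have D: "((\<lambda>x. f x + h x) has_derivative
      (\<lambda>v. frechet_derivative f (at x) v + frechet_derivative h (at x) v)) (at x)"
    if "x \<in> S" for x
    using Suc.prems that by (intro has_derivative_add) (auto simp: frechet_derivative_works)
  have "Ck_on k S (\<lambda>x. frechet_derivative (\<lambda>x. f x + h x) (at x) v)" for v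
    by (rule Ck_on_cong[OF assms(1), of
          "\<lambda>x. frechet_derivative f (at x) v + frechet_derivative h (at x) v"])
      (use Suc in \<open>auto simp: frechet_derivative_at[OF D, symmetric]\<close>)
  with D show ?case by (auto simp: differentiable_def)
qed

lemma Ck_on_mult:
  fixes f h :: "'e::real_normed_vector \<Rightarrow> real"
  assumes "open S" "Ck_on k S f" "Ck_on k S h"
  shows "Ck_on k S (\<lambda>x. f x * h x)"
  using assms(2,3)
proof (induction k arbitrary: f h)
  case 0
  then show ?case by (auto intro: continuous_intros)
next
  case (Suc k)
  have D: "((\<lambda>x. f x * h x) has_derivative
      (\<lambda>v. f x * frechet_derivative h (at x) v + frechet_derivative f (at x) v * h x)) (at x)"
    if "x \<in> S" for x
    using Suc.prems that by (intro has_derivative_mult) (auto simp: frechet_derivative_works)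
  \<comment> \<open>The product rule also contains the undifferentiated factors, so the induction
    hypothesis needs them one order lower.\<close>
  have lower: "Ck_on k S f" "Ck_on k S h"
    using Suc.prems by (blast intro: Ck_on_Suc_imp)+
  have "Ck_on k S (\<lambda>x. frechet_derivative (\<lambda>x. f x * h x) (at x) v)" for v
    by (rule Ck_on_cong[OF assms(1), of
          "\<lambda>x. f x * frechet_derivative h (at x) v + frechet_derivative f (at x) v * h x"])
      (use Suc.prems lower in \<open>auto intro!: Ck_on_add[OF assms(1)] Suc.IH
          simp: frechet_derivative_at[OF D, symmetric]\<close>)
  with D show ?case by (auto simp: differentiable_def)
qed

text \<open>The chain rule turns \<open>K j\<close> into \<open>K (Suc j)\<close>, so the induction
  runs over a whole sequence of successive derivatives with \<open>j\<close> arbitrary.\<close>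

lemma Ck_on_compose_real:
  fixes F :: "'e::real_normed_vector \<Rightarrow> real" and K :: "nat \<Rightarrow> real \<Rightarrow> real"
  assumes "open S" "\<And>j s. (K j has_real_derivative K (Suc j) s) (at s)" "Ck_on k S F"
  shows "Ck_on k S (\<lambda>x. K j (F x))"
  using assms(3)
proof (induction k arbitrary: j)
  case 0
  have "continuous_on UNIV (K j)"
    using assms(2) by (intro DERIV_continuous_on) blast
  then show ?case
    using 0 by (auto intro: continuous_on_compose2)
next
  case (Suc k)
  have D: "((\<lambda>x. K j (F x)) has_derivative
      (\<lambda>v. K (Suc j) (F x) * frechet_derivative F (at x) v)) (at x)" if "x \<in> S" for x
    using Suc.prems that
    by (intro has_derivative_compose[of F _ _ _ "K j"])
      (auto simp: frechet_derivative_works has_field_derivative_imp_has_derivative assms(2))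
  have "Ck_on k S (\<lambda>x. frechet_derivative (\<lambda>x. K j (F x)) (at x) v)" for v
    by (rule Ck_on_cong[OF assms(1), of
          "\<lambda>x. K (Suc j) (F x) * frechet_derivative F (at x) v"])
      (use Suc.IH[of "Suc j"] Suc.prems Ck_on_Suc_imp[OF Suc.prems] in
        \<open>auto intro!: Ck_on_mult[OF assms(1)] simp: frechet_derivative_at[OF D, symmetric]\<close>)
  with D show ?case
    by (auto simp: differentiable_def)
qed

section \<open>Smooth functions on the manifold\<close>

lemma smooth_atlas_open_image:
  assumes "smooth_atlas \<A>" "(V, \<psi>) \<in> \<A>"
  shows "open (\<psi> ` V)"
  using assms by (force simp: smooth_atlas_def is_chart_def)

lemma smooth_fun_const: "smooth_fun \<A> (\<lambda>q. r)"
  by (auto simp: smooth_fun_def smooth_on_def o_def Ck_on_const)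

lemma smooth_fun_add:
  assumes "smooth_atlas \<A>" "smooth_fun \<A> h" "smooth_fun \<A> k"
  shows "smooth_fun \<A> (\<lambda>q. h q + k q)"
  using assms smooth_atlas_open_image[OF assms(1)]
  by (fastforce simp: smooth_fun_def smooth_on_def o_def intro: Ck_on_add)

lemma smooth_fun_mult:
  assumes "smooth_atlas \<A>" "smooth_fun \<A> h" "smooth_fun \<A> k"
  shows "smooth_fun \<A> (\<lambda>q. h q * k q)"
  using assms smooth_atlas_open_image[OF assms(1)]
  by (fastforce simp: smooth_fun_def smooth_on_def o_def intro: Ck_on_mult)

lemma smooth_fun_compose_real:
  assumes "smooth_atlas \<A>" "\<And>j s. (K j has_real_derivative K (Suc j) s) (at s)"
    and "smooth_fun \<A> h"
  shows "smooth_fun \<A> (\<lambda>q. K j (h q))"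
  using assms(3) smooth_atlas_open_image[OF assms(1)] assms(2)
  by (fastforce simp: smooth_fun_def smooth_on_def o_def intro: Ck_on_compose_real)

text \<open>\<open>K 0\<close> is the entire function (exp s - 1) / s with its singularity at 0
  removed, and \<open>K j\<close> is its j-th derivative, as \<open>Ck_on_compose_real\<close>
  requires.\<close>

lemma exp_minus_one_factorization:
  obtains K :: "nat \<Rightarrow> real \<Rightarrow> real"
  where "\<And>j s. (K j has_real_derivative K (Suc j) s) (at s)"
    and "\<And>s. exp s = 1 + s * K 0 s" and "K 0 0 = 1"
proof -
  \<comment> \<open>These are the exponential coefficients shifted by one: the constant term is
    dropped and one factor s is divided out.\<close>
  define a :: "nat \<Rightarrow> real" where "a n = 1 / fact (Suc n)" for n
  define K where "K j s = (\<Sum>n. (diffs ^^ j) a n * s ^ n)" for j and s :: real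
  have exp_sums: "(\<lambda>n. s ^ n / fact n) sums exp s" for s :: real
    using exp_converges[of s] by (simp add: field_simps)
  have sums_a: "(\<lambda>n. s * (a n * s ^ n)) sums (exp s - 1)" for s :: real
    using sums_Suc_iff[of "\<lambda>n. s ^ n / fact n" "exp s - 1"] exp_sums[of s]
    by (simp add: a_def)
  have summable_a: "summable (\<lambda>n. a n * s ^ n)" for s :: real
  proof (cases "s = 0")
    case True
    then show ?thesis by (simp add: summable_0_powser)
  next
    case False
    then show ?thesis
      using sums_summable[OF sums_a[of s]] by (simp add: summable_cmult_iff)
  qed
  have sm: "summable (\<lambda>n. (diffs ^^ j) a n * s ^ n)" for j and s :: real
  proof (induction j arbitrary: s)
    case 0
    then show ?case by (simp add: summable_a)
  next
    case (Suc j)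
    then show ?case by (auto intro: termdiff_converges_all)
  qed
  have "(K j has_real_derivative K (Suc j) s) (at s)" for j s
    using termdiffs_strong_converges_everywhere[OF sm, of j s] unfolding K_def by simp
  moreover have "exp s = 1 + s * K 0 s" for s
    using sums_unique[OF sums_a[of s]] suminf_mult[OF summable_a, of s s]
    by (simp add: K_def)
  moreover have "K 0 0 = 1"
    using powser_zero[of a] by (simp add: K_def) (simp add: a_def)
  ultimately show thesis by (rule that)
qed

section \<open>Tangent vectors\<close>

lemma tangent_space_add:
  "v \<in> tangent_space \<A> p \<Longrightarrow> w \<in> tangent_space \<A> p \<Longrightarrow> v + w \<in> tangent_space \<A> p"
  by (auto simp: tangent_space_def algebra_simps)

lemma tangent_space_scale: "v \<in> tangent_space \<A> p \<Longrightarrow> tscale r v \<in> tangent_space \<A> p"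
  by (auto simp: tangent_space_def tscale_def algebra_simps)

lemma tangent_space_zero: "0 \<in> tangent_space \<A> p"
  by (auto simp: tangent_space_def)

lemma tangent_space_minus: "v \<in> tangent_space \<A> p \<Longrightarrow> - v \<in> tangent_space \<A> p"
  by (auto simp: tangent_space_def algebra_simps)

lemma tangent_space_diff:
  "v \<in> tangent_space \<A> p \<Longrightarrow> w \<in> tangent_space \<A> p \<Longrightarrow> v - w \<in> tangent_space \<A> p"
  using tangent_space_add[OF _ tangent_space_minus] by force

lemma vector_field_tangent: "vector_field \<A> X \<Longrightarrow> X p \<in> tangent_space \<A> p"
  by (simp add: vector_field_def)

lemma tangent_vector_const:
  assumes "v \<in> tangent_space \<A> p"
  shows "v (\<lambda>q. r) = 0"
proof -
  \<comment> \<open>The Leibniz rule for 1 = 1 * 1 forces v(1) = 2 v(1), hence v(1) = 0.\<close>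
  have "v (\<lambda>q. r * 1) = r * v (\<lambda>q. 1)" "v (\<lambda>q. 1 * 1) = 1 * v (\<lambda>q. 1) + 1 * v (\<lambda>q. 1)"
    using assms smooth_fun_const[of \<A> 1] unfolding tangent_space_def by blast+
  then show ?thesis by simp
qed

text \<open>
  For abstract derivations the chain rule is not available; writing \<open>e\<^sup>s = 1 + s K(s)\<close> with
  \<open>K\<close> smooth reduces it to the Leibniz rule, without charts or bump functions.
\<close>

lemma tangent_vector_exp:
  assumes "smooth_atlas \<A>" "v \<in> tangent_space \<A> p" "smooth_fun \<A> f"
  shows "v (\<lambda>q. exp (f q)) = exp (f p) * v f"
proof -
  obtain K :: "nat \<Rightarrow> real \<Rightarrow> real"
    where K: "\<And>j s. (K j has_real_derivative K (Suc j) s) (at s)"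
      and e: "\<And>s. exp s = 1 + s * K 0 s" and K0: "K 0 0 = 1"
    using exp_minus_one_factorization by blast
  \<comment> \<open>The shift makes \<open>d\<close> vanish at \<open>p\<close>, so the Leibniz rule
    for \<open>d * m\<close> leaves only \<open>m p * v d\<close>, where
    \<open>m p = K 0 0 = 1\<close>.\<close>
  define d where "d q = f q + - f p" for q
  define m where "m q = K 0 (d q)" for q
  have sd: "smooth_fun \<A> d"
    unfolding d_def by (intro smooth_fun_add assms smooth_fun_const)
  have sm: "smooth_fun \<A> m"
    unfolding m_def by (rule smooth_fun_compose_real[of \<A> K d 0]) (use assms(1) K sd in auto)
  have sdm: "smooth_fun \<A> (\<lambda>q. d q * m q)"
    by (rule smooth_fun_mult[OF assms(1) sd sm])
  have add: "v (\<lambda>q. h q + k q) = v h + v k" if "smooth_fun \<A> h" "smooth_fun \<A> k" for h k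
    using assms(2) that by (simp add: tangent_space_def)
  have scale: "v (\<lambda>q. r * h q) = r * v h" if "smooth_fun \<A> h" for r h
    using assms(2) that by (simp add: tangent_space_def)
  have mult: "v (\<lambda>q. h q * k q) = h p * v k + k p * v h" if "smooth_fun \<A> h" "smooth_fun \<A> k" for h k
    using assms(2) that by (simp add: tangent_space_def)
  have "(\<lambda>q. exp (f q)) = (\<lambda>q. exp (f p) * (1 + d q * m q))"
  proof
    fix q
    have "exp (f q) = exp (f p) * exp (d q)"
      by (simp add: d_def flip: exp_add)
    then show "exp (f q) = exp (f p) * (1 + d q * m q)"
      using e[of "d q"] by (simp add: m_def)
  qed
  then have "v (\<lambda>q. exp (f q)) = exp (f p) * v (\<lambda>q. 1 + d q * m q)"
    using scale[OF smooth_fun_add[OF assms(1) smooth_fun_const sdm]] by simp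
  also have "\<dots> = exp (f p) * v (\<lambda>q. d q * m q)"
    using add[OF smooth_fun_const sdm] tangent_vector_const[OF assms(2)] by simp
  also have "\<dots> = exp (f p) * v d"
    using mult[OF sd sm] by (simp add: d_def m_def K0)
  also have "v d = v f"
    using add[OF assms(3) smooth_fun_const[of _ "- f p"]] tangent_vector_const[OF assms(2)]
    by (simp add: d_def[abs_def])
  finally show ?thesis .
qed

text \<open>\<open>v\<close> is the velocity of a curve inside \<open>S\<close>, along which
  \<open>h\<close> is constantly 0. Thus identities known only on \<open>S\<close> may be
  differentiated in directions tangent to \<open>S\<close>.\<close>

lemma tangent_space_sub_vanishing:
  assumes "v \<in> tangent_space_sub \<A> S p" "smooth_fun \<A> h" "\<And>q. q \<in> S \<Longrightarrow> h q = 0"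
  shows "v h = 0"
proof -
  obtain \<gamma> \<epsilon> where "0 < \<epsilon>" and S: "\<gamma> ` {-\<epsilon><..<\<epsilon>} \<subseteq> S"
    and v: "v h = deriv (h \<circ> \<gamma>) 0"
    using assms(1,2) unfolding tangent_space_sub_def by blast
  have "\<forall>\<^sub>F t in nhds 0. t \<in> {-\<epsilon><..<\<epsilon>}"
    using \<open>0 < \<epsilon>\<close> by (intro eventually_nhds_in_open) auto
  then have "\<forall>\<^sub>F t in nhds 0. (h \<circ> \<gamma>) t = 0"
    by eventually_elim (use S assms(3) in \<open>auto simp: image_subset_iff\<close>)
  then have "deriv (h \<circ> \<gamma>) 0 = deriv (\<lambda>t. 0) 0"
    by (rule deriv_cong_ev) simp
  with v show ?thesis by simp
qed

section \<open>Metrics and connections\<close>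

lemma riemannian_metric_add:
  "\<lbrakk>riemannian_metric \<A> g; u \<in> tangent_space \<A> p; v \<in> tangent_space \<A> p; w \<in> tangent_space \<A> p\<rbrakk>
    \<Longrightarrow> g p (u + v) w = g p u w + g p v w"
  by (simp add: riemannian_metric_def)

lemma riemannian_metric_scale:
  "\<lbrakk>riemannian_metric \<A> g; v \<in> tangent_space \<A> p; w \<in> tangent_space \<A> p\<rbrakk>
    \<Longrightarrow> g p (tscale r v) w = r * g p v w"
  by (simp add: riemannian_metric_def)

lemma riemannian_metric_sym:
  "\<lbrakk>riemannian_metric \<A> g; v \<in> tangent_space \<A> p; w \<in> tangent_space \<A> p\<rbrakk>
    \<Longrightarrow> g p v w = g p w v"
  by (simp add: riemannian_metric_def)

lemma riemannian_metric_smooth: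
  "\<lbrakk>riemannian_metric \<A> g; vector_field \<A> X; vector_field \<A> Y\<rbrakk>
    \<Longrightarrow> smooth_fun \<A> (\<lambda>p. g p (X p) (Y p))"
  by (simp add: riemannian_metric_def)

lemma riemannian_metric_diff:
  assumes "riemannian_metric \<A> g" "u \<in> tangent_space \<A> p" "v \<in> tangent_space \<A> p"
    "w \<in> tangent_space \<A> p"
  shows "g p (u - v) w = g p u w - g p v w"
  using riemannian_metric_add[OF assms(1) tangent_space_diff[OF assms(2,3)] assms(3,4)] by simp

lemma levi_civita_vector_field:
  "levi_civita \<A> g nab \<Longrightarrow> vector_field \<A> X \<Longrightarrow> vector_field \<A> Y \<Longrightarrow> vector_field \<A> (nab X Y)"
  by (simp add: levi_civita_def affine_connection_def)

lemma levi_civita_metric: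
  "\<lbrakk>levi_civita \<A> g nab; vector_field \<A> X; vector_field \<A> Y; vector_field \<A> Z\<rbrakk>
    \<Longrightarrow> X p (\<lambda>q. g q (Y q) (Z q)) = g p (nab X Y p) (Z p) + g p (Y p) (nab X Z p)"
  by (simp add: levi_civita_def)

text \<open>This is the Koszul formula with two equal arguments, obtained from two instances of
  metric compatibility and the vanishing torsion. Its right-hand side contains no connection, so it
  can be compared between conformal metrics.\<close>

lemma levi_civita_koszul_diagonal:
  assumes g: "riemannian_metric \<A> g" and lc: "levi_civita \<A> g nab"
    and X: "vector_field \<A> X" and Z: "vector_field \<A> Z"
  shows "g p (nab X X p) (Z p) =
    X p (\<lambda>q. g q (X q) (Z q)) - Z p (\<lambda>q. g q (X q) (X q)) / 2 + g p (lie_bracket Z X p) (X p)"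
proof -
  note T = vector_field_tangent
  note V = levi_civita_vector_field[OF lc]
  have "lie_bracket Z X = nab Z X - nab X Z"
    using lc X Z by (simp add: levi_civita_def)
  then have "g p (lie_bracket Z X p) (X p) = g p (nab Z X p) (X p) - g p (nab X Z p) (X p)"
    by (simp add: riemannian_metric_diff[OF g T[OF V[OF Z X]] T[OF V[OF X Z]] T[OF X]])
  moreover have "g p (X p) (nab Z X p) = g p (nab Z X p) (X p)"
    "g p (X p) (nab X Z p) = g p (nab X Z p) (X p)"
    by (auto intro: riemannian_metric_sym[OF g] T V X Z)
  ultimately show ?thesis
    using levi_civita_metric[OF lc X X Z, of p] levi_civita_metric[OF lc Z X X, of p] by simp
qed

text \<open>The Kenmotsu identity at (\<xi>, \<xi>), with \<phi>\<xi> = 0, puts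
  \<open>nab \<xi> \<xi>\<close> in the kernel of \<phi>, which is spanned by \<xi>. The constant
  length of \<xi> then removes the remaining multiple of \<xi>.\<close>

lemma kenmotsu_reeb_geodesic:
  assumes "kenmotsu \<A> \<phi> \<xi> \<eta> g"
  obtains nab where "levi_civita \<A> g nab" "nab \<xi> \<xi> = 0"
proof -
  obtain nab where lc: "levi_civita \<A> g nab"
    and ken: "\<And>X Y p. vector_field \<A> X \<Longrightarrow> vector_field \<A> Y \<Longrightarrow> cov_deriv_11 nab \<phi> X Y p =
             tscale (- g p (X p) (\<phi> p (Y p))) (\<xi> p) - tscale (\<eta> p (Y p)) (\<phi> p (X p))"
    using assms unfolding kenmotsu_def by blast
  have ac: "almost_contact_metric \<A> \<phi> \<xi> \<eta> g"
    using assms by (simp add: kenmotsu_def)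
  then have \<xi>: "vector_field \<A> \<xi>" and g: "riemannian_metric \<A> g" and \<phi>: "tensor_field_11 \<A> \<phi>"
    and \<phi>\<xi>: "\<And>p. \<phi> p (\<xi> p) = 0" and \<eta>\<xi>: "\<And>p. \<eta> p (\<xi> p) = 1"
    and sq: "\<And>p v. v \<in> tangent_space \<A> p \<Longrightarrow> \<phi> p (\<phi> p v) = - v + tscale (\<eta> p v) (\<xi> p)"
    and \<eta>: "\<And>p v. v \<in> tangent_space \<A> p \<Longrightarrow> \<eta> p v = g p v (\<xi> p)"
    by (auto simp: almost_contact_metric_def)
  note T = vector_field_tangent
  have "nab \<xi> \<xi> p = 0" for p
  proof -
    let ?w = "nab \<xi> \<xi> p"
    have w: "?w \<in> tangent_space \<A> p"
      by (intro T levi_civita_vector_field[OF lc] \<xi>)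
    have "vector_field \<A> (\<lambda>q. \<phi> q (\<xi> q))"
      using \<phi> \<xi> unfolding tensor_field_11_def by blast
    \<comment> \<open>The zero field is smooth because it equals \<phi>\<xi>; additivity of
      \<open>nab \<xi>\<close> then gives \<open>nab \<xi> 0 = 0\<close>.\<close>
    then have "vector_field \<A> 0"
      by (simp only: \<phi>\<xi> flip: zero_fun_def)
    then have "nab \<xi> (0 + 0) = nab \<xi> 0 + nab \<xi> 0"
      using lc \<xi> unfolding levi_civita_def affine_connection_def by blast
    then have "nab \<xi> (\<lambda>q. \<phi> q (\<xi> q)) = 0"
      by (simp add: \<phi>\<xi> flip: zero_fun_def)
    moreover have "g p (\<xi> p) 0 = 0"
      using riemannian_metric_sym[OF g T[OF \<xi>] tangent_space_zero, of p]
        riemannian_metric_add[OF g tangent_space_zero tangent_space_zero T[OF \<xi>], of p] by simp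
    ultimately have "\<phi> p ?w = 0"
      using ken[OF \<xi> \<xi>, of p] by (simp add: cov_deriv_11_def \<phi>\<xi> \<eta>\<xi>)
    moreover have "\<phi> p (0 + 0) = \<phi> p 0 + \<phi> p 0"
      using \<phi> tangent_space_zero[of \<A> p] unfolding tensor_field_11_def by blast
    ultimately have "?w = tscale (\<eta> p ?w) (\<xi> p)"
      using sq[OF w] by simp
    moreover have "\<eta> p ?w = 0"
    proof -
      have "(\<lambda>q. g q (\<xi> q) (\<xi> q)) = (\<lambda>q. 1)"
        using \<eta>[OF T[OF \<xi>]] \<eta>\<xi> by metis
      then have "0 = g p ?w (\<xi> p) + g p (\<xi> p) ?w"
        using levi_civita_metric[OF lc \<xi> \<xi> \<xi>, of p] tangent_vector_const[OF T[OF \<xi>]] by simp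
      then show ?thesis
        using \<eta>[OF w] riemannian_metric_sym[OF g w T[OF \<xi>]] by simp
    qed
    ultimately show ?thesis by simp
  qed
  then have "nab \<xi> \<xi> = 0"
    by (simp add: fun_eq_iff)
  with lc show thesis
    by (rule that)
qed

text \<open>Expanding \<nabla> of hX along hX gives h (h \<nabla>_X X + X(h) X). Where h is nonzero,
  its vanishing makes \<nabla>_X X a multiple of X, hence orthogonal to whatever is orthogonal to
  X.\<close>

lemma levi_civita_geodesic_rescale:
  assumes g: "riemannian_metric \<A> g" and lc: "levi_civita \<A> g nab"
    and X: "vector_field \<A> X" and Z: "vector_field \<A> Z" and h: "smooth_fun \<A> h"
    and geod: "nab (vscale h X) (vscale h X) = 0" and X': "vector_field \<A> (vscale h X)"
    and nz: "h p \<noteq> 0" and orth: "g p (X p) (Z p) = 0"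
  shows "g p (nab X X p) (Z p) = 0"
proof -
  note T = vector_field_tangent
  have aff: "affine_connection \<A> nab"
    using lc by (simp add: levi_civita_def)
  have "nab (vscale h X) (vscale h X) = vscale h (nab X (vscale h X))"
    "nab X (vscale h X) = vscale h (nab X X) + vscale (\<lambda>p. X p h) X"
    using aff X X' h unfolding affine_connection_def by blast+
  then have "tscale (h p) (tscale (h p) (nab X X p) + tscale (X p h) (X p)) = 0"
    using fun_cong[OF geod, of p] by (simp add: vscale_def)
  then have "tscale (h p) (nab X X p) + tscale (X p h) (X p) = 0"
    using nz by simp
  moreover have "nab X X p \<in> tangent_space \<A> p"
    by (intro T levi_civita_vector_field[OF lc] X)
  moreover have "g p 0 (Z p) = 0"
    using riemannian_metric_add[OF g tangent_space_zero tangent_space_zero T[OF Z], of p] by simp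
  ultimately have "h p * g p (nab X X p) (Z p) + X p h * g p (X p) (Z p) = 0"
    using riemannian_metric_add[OF g tangent_space_scale tangent_space_scale T[OF Z],
        of "nab X X p" p "X p" "h p" "X p h"]
      riemannian_metric_scale[OF g _ T[OF Z]] T[OF X, of p] by metis
  with nz orth show ?thesis by simp
qed

section \<open>The normal component of \<open>nab \<xi> \<xi>\<close> along \<open>S\<close>\<close>

theorem theorem5p4:
  fixes \<A> :: "('a::{t2_space, second_countable_topology}, 'e::euclidean_space) chart set"
    and n :: nat
    and \<phi> :: "'a \<Rightarrow> 'a tvec \<Rightarrow> 'a tvec"
    and \<xi> :: "'a vfield"
    and \<eta> :: "'a \<Rightarrow> 'a tvec \<Rightarrow> real"
    and g :: "'a \<Rightarrow> 'a tvec \<Rightarrow> 'a tvec \<Rightarrow> real"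
    and f :: "'a \<Rightarrow> real"
    and c :: real
    and nab :: "'a vfield \<Rightarrow> 'a vfield \<Rightarrow> 'a vfield"
    and S :: "'a set"
    and D D' :: "'a \<Rightarrow> 'a tvec set"
    and N U L :: "'a vfield"
    and A :: "'a \<Rightarrow> 'a tvec \<Rightarrow> 'a tvec"
    and lam :: "'a \<Rightarrow> real"
  assumes "smooth_atlas \<A>" and "DIM('e) = 2 * n + 1"
    and "conformal_kenmotsu_space_form \<A> \<phi> \<xi> \<eta> g f c"
    and "levi_civita \<A> g nab"
    and "CR_hypersurface \<A> n \<phi> \<xi> g S D D'"
    and "unit_normal_field \<A> g S N"
    and "\<And>p. p \<in> S \<Longrightarrow> U p = - \<phi> p (N p)"
    and "\<And>p. p \<in> S \<Longrightarrow> D' p = tvec.span {U p, \<xi> p}"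
    and "\<And>p. p \<in> S \<Longrightarrow> D p = {v \<in> tangent_space_sub \<A> S p. \<forall>w\<in>D' p. g p v w = 0}"
    and "shape_operator \<A> nab S N A"
    and "\<And>p v. p \<in> S \<Longrightarrow> v \<in> tangent_space_sub \<A> S p \<Longrightarrow> A p v = tscale (lam p) v"
    and "gradient \<A> g f L"
    and "\<And>p. p \<in> S \<Longrightarrow> L p = N p"
  shows "\<forall>p\<in>S. lam p = 1 / 2"
proof
  fix p assume p: "p \<in> S"
  note T = vector_field_tangent
  let ?h = "\<lambda>p. exp (- f p / 2)"
  let ?\<xi>' = "vscale ?h \<xi>"
  let ?g' = "\<lambda>p v w. exp (f p) * g p v w"
  have ck: "conformal_kenmotsu \<A> \<phi> \<xi> \<eta> g f"
    using assms(3) by (simp add: conformal_kenmotsu_space_form_def)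
  then have ac: "almost_contact_metric \<A> \<phi> \<xi> \<eta> g" and sf: "smooth_fun \<A> f"
    and ken: "kenmotsu \<A> \<phi> ?\<xi>' (\<lambda>p v. exp (f p / 2) * \<eta> p v) ?g'"
    by (auto simp: conformal_kenmotsu_def)
  have \<xi>: "vector_field \<A> \<xi>" and g: "riemannian_metric \<A> g"
    using ac by (auto simp: almost_contact_metric_def)
  have g\<xi>\<xi>: "g q (\<xi> q) (\<xi> q) = 1" for q
    using ac T[OF \<xi>] by (metis almost_contact_metric_def)
  have \<xi>': "vector_field \<A> ?\<xi>'" and g': "riemannian_metric \<A> ?g'"
    using ken by (auto simp: kenmotsu_def almost_contact_metric_def)
  obtain nab' where lc': "levi_civita \<A> ?g' nab'" and geod: "nab' ?\<xi>' ?\<xi>' = 0"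
    using kenmotsu_reeb_geodesic[OF ken] by blast
  have L: "vector_field \<A> L" and grad: "\<And>q v. v \<in> tangent_space \<A> q \<Longrightarrow> g q (L q) v = v f"
    using assms(12) by (auto simp: gradient_def)
  have \<xi>S: "\<xi> q \<in> tangent_space_sub \<A> S q" if "q \<in> S" for q
    using assms(5)[unfolded CR_hypersurface_def, THEN conjunct2, THEN conjunct1] that
    by (rule bspec)
  have orth: "g q (\<xi> q) (L q) = 0" if "q \<in> S" for q
    using assms(6) assms(13)[OF that] \<xi>S[OF that] that
      riemannian_metric_sym[OF g T[OF \<xi>] T[OF L], of q]
    by (simp add: unit_normal_field_def normal_space_sub_def)
  \<comment> \<open>Evaluating the gradient identity on \<open>L\<close> itself gives L(f) = g(L,
    L), which is g(N, N) = 1 at \<open>p\<close>.\<close>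
  have "L p f = 1"
    using grad[OF T[OF L], of p] assms(6) assms(13)[OF p] p by (simp add: unit_normal_field_def)
  then have Lexp: "L p (\<lambda>q. exp (f q)) = exp (f p)"
    using tangent_vector_exp[OF assms(1) T[OF L] sf, of p] by simp
  \<comment> \<open>Orthogonality is known only on \<open>S\<close>, but \<xi> is tangent to
    \<open>S\<close>, so its derivative along \<xi> vanishes for both metrics.\<close>
  have \<xi>gL: "\<xi> p (\<lambda>q. g q (\<xi> q) (L q)) = 0"
    by (rule tangent_space_sub_vanishing[OF \<xi>S[OF p] riemannian_metric_smooth[OF g \<xi> L]])
      (rule orth)
  have \<xi>gL': "\<xi> p (\<lambda>q. exp (f q) * g q (\<xi> q) (L q)) = 0"
    by (rule tangent_space_sub_vanishing[OF \<xi>S[OF p] riemannian_metric_smooth[OF g' \<xi> L]])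
      (simp add: orth)
  \<comment> \<open>The conformal factor is smooth because it is a metric coefficient of smooth fields.\<close>
  have "(\<lambda>q. g q (?\<xi>' q) (\<xi> q)) = ?h"
    using riemannian_metric_scale[OF g T[OF \<xi>] T[OF \<xi>]] by (simp add: vscale_def g\<xi>\<xi>)
  then have "smooth_fun \<A> ?h"
    using riemannian_metric_smooth[OF g \<xi>' \<xi>] by simp
  then have "?g' p (nab' \<xi> \<xi> p) (L p) = 0"
    by (rule levi_civita_geodesic_rescale[OF g' lc' \<xi> L _ geod \<xi>']) (use orth[OF p] in auto)
  \<comment> \<open>In the rescaled metric \<xi> has squared length e^f, whose derivative along
    \<open>L\<close> at \<open>p\<close> is e^f. With the left side and the \<xi>-derivative zero,
    the Koszul formula determines the bracket term.\<close>
  then have "exp (f p) * g p (lie_bracket L \<xi> p) (\<xi> p) = exp (f p) / 2"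
    using levi_civita_koszul_diagonal[OF g' lc' \<xi> L, of p] \<xi>gL' by (simp add: g\<xi>\<xi> Lexp)
  then have "g p (lie_bracket L \<xi> p) (\<xi> p) = 1 / 2"
    by (simp add: field_simps)
  \<comment> \<open>For \<open>g\<close> the field \<xi> has constant length, so the Koszul formula
    reduces to the same bracket term.\<close>
  then have geo: "g p (nab \<xi> \<xi> p) (L p) = 1 / 2"
    using levi_civita_koszul_diagonal[OF g assms(4) \<xi> L, of p] \<xi>gL tangent_vector_const[OF T[OF L]]
    by (simp add: g\<xi>\<xi>)
  \<comment> \<open>The gradient field is a global smooth extension of \<open>N\<close>, so the
    shape operator can be computed with it.\<close>
  have "extends_near \<A> S N p L"
    unfolding extends_near_def using L assms(13) by (intro conjI exI[of _ UNIV]) auto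
  then have "A p (\<xi> p) = - nab \<xi> L p"
    using assms(10) \<xi> \<xi>S[OF p] p by (simp add: shape_operator_def)
  then have "tscale (lam p) (\<xi> p) = - nab \<xi> L p"
    using assms(11)[OF p \<xi>S[OF p]] by simp
  then have "nab \<xi> L p = tscale (- lam p) (\<xi> p)"
    by (simp add: equation_minus_iff)
  then have "g p (nab \<xi> L p) (\<xi> p) = - lam p"
    by (simp only: riemannian_metric_scale[OF g T[OF \<xi>] T[OF \<xi>]] g\<xi>\<xi> mult_1_right)
  moreover have "g p (\<xi> p) (nab \<xi> L p) = g p (nab \<xi> L p) (\<xi> p)"
    by (intro riemannian_metric_sym[OF g] T levi_civita_vector_field[OF assms(4)] \<xi> L)
  \<comment> \<open>Differentiating g(\<xi>, L) along \<xi> gives 0 = 1/2 -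
    \<open>lam p\<close>.\<close>
  ultimately show "lam p = 1 / 2"
    using levi_civita_metric[OF assms(4) \<xi> \<xi> L, of p] \<xi>gL geo by simp
qed

end
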